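(* Assume that $\|f(t,x)\|\le l(t)\|x\|$ for all $x\in\Omega$ and all $t\ge t_0$, where $\Omega\subset\mathbb{R}^n$ is a neighborhood of $0$ and $l$ is continuous with $l(t)\le\hat l$ for a constant $\hat l$. Let $\sup\,(p(t)+k(t)l(t))<-v_1$, the supremum being over all $t>t_1$, for some $v_1>0$ and some $t_1\ge t_0$. Then the solution $x=0$ of $\dot x=A(t)x+f(t,x)$ is exponentially stable. If, in addition, $\|F(t)\|\le F_0$ for all $t\ge t_0$ and both $F_0$ and $\|x_0\|$ are sufficiently small, then the corresponding solutions $x(t,x_0)$ of $\dot x=A(t)x+f(t,x)+F(t)$, $x(t_0,x_0)=x_0$, are bounded.
   Context: Here $t\in[t_0,\infty)$, $x\in\mathbb{R}^n$, $f(t,0)=0$; $A(t)\in\mathbb{R}^{n\times n}$, $f:[t_0,\infty)\times\mathbb{R}^n\to\mathbb{R}^n$ and $F(t)\in\mathbb{R}^n$ are continuous and bounded, and $A$ is continuously differentiable. Solutions of the initial value problems at $t_0$ are assumed to be uniquely defined for all $t\ge t_0$. $\|\cdot\|$ is the Euclidean norm for vectors and the induced (spectral) norm for matrices. $W(t)$ is a fundamental solution matrix of $\dot x=A(t)x$ with $\|W(t_0)\|=1$; $\sigma_{\max}(t)$ and $\sigma_{\min}(t)$ are its largest and smallest singular values. Standing assumptions: $\sigma_{\max}(t)$ is unique (a simple singular value) for every $t\ge t_0$, and $\sup_{t\ge t_0}\sigma_{\max}\le\bar\sigma$, $\inf_{t\ge t_0}\sigma_{\min}\ge\underline\sigma$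 for constants $\bar\sigma,\underline\sigma$. Definitions: $p(t)=\frac{d}{dt}\ln\|W(t)\|$, assumed continuous, and $k(t)=\|W(t)\|\,\|W^{-1}(t)\|=\sigma_{\max}(t)/\sigma_{\min}(t)$, assumed continuous and bounded. *)

theory Defs
  imports "HOL-Analysis.Analysis"
begin

definition spec_norm :: "real^'n^'m \<Rightarrow> real" where
  "spec_norm M = onorm (\<lambda>x. M *v x)"

definition cond_number :: "real^'n^'n \<Rightarrow> real" where
  "cond_number M = spec_norm M * spec_norm (matrix_inv M)"

text \<open>The \<open>e\<close>-eigenspace of \<open>M\<^sup>T M\<close>; its dimension for \<open>e = \<sigma>\<^sup>2\<close> is the multiplicity of
  the singular value \<open>\<sigma> \<ge> 0\<close>, since \<open>M\<^sup>T M\<close> is symmetric.\<close>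

definition gram_eigenspace :: "real^'n^'m \<Rightarrow> real \<Rightarrow> (real^'n) set" where
  "gram_eigenspace M e = {v. (transpose M ** M) *v v = e *\<^sub>R v}"

definition singular_values :: "real^'n^'m \<Rightarrow> real set" where
  "singular_values M = {s. 0 \<le> s \<and> (\<exists>v. v \<noteq> 0 \<and> v \<in> gram_eigenspace M (s\<^sup>2))}"

text \<open>The set of singular values is finite and nonempty, so \<open>Max\<close> and \<open>Min\<close> are meaningful.\<close>

definition sigma_max :: "real^'n^'m \<Rightarrow> real" where
  "sigma_max M = Max (singular_values M)"

definition sigma_min :: "real^'n^'m \<Rightarrow> real" where
  "sigma_min M = Min (singular_values M)"

definition simple_singular_value :: "real^'n^'m \<Rightarrow> real \<Rightarrow> bool" where
  "simple_singular_value M s \<longleftrightarrow> s \<in> singular_values M \<and> dim (gram_eigenspace M (s\<^sup>2)) = 1"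

text \<open>Derivatives are taken within \<open>{t0..}\<close>, hence one-sided at the initial time.\<close>

definition ivp_solution ::
  "(real \<Rightarrow> 'a::real_normed_vector \<Rightarrow> 'a) \<Rightarrow> real \<Rightarrow> 'a \<Rightarrow> (real \<Rightarrow> 'a) \<Rightarrow> bool" where
  "ivp_solution g t0 x0 x \<longleftrightarrow>
     x t0 = x0 \<and> (\<forall>t\<ge>t0. (x has_vector_derivative g t (x t)) (at t within {t0..}))"

definition ivp_uniquely_solvable ::
  "(real \<Rightarrow> 'a::real_normed_vector \<Rightarrow> 'a) \<Rightarrow> real \<Rightarrow> bool" where
  "ivp_uniquely_solvable g t0 \<longleftrightarrow>
     (\<forall>x0. \<exists>x. ivp_solution g t0 x0 x \<and>
        (\<forall>y. ivp_solution g t0 x0 y \<longrightarrow> (\<forall>t\<ge>t0. y t = x t)))"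

definition fundamental_matrix ::
  "(real \<Rightarrow> real^'n^'n) \<Rightarrow> real \<Rightarrow> (real \<Rightarrow> real^'n^'n) \<Rightarrow> bool" where
  "fundamental_matrix A t0 W \<longleftrightarrow>
     (\<forall>t\<ge>t0. (W has_vector_derivative A t ** W t) (at t within {t0..}) \<and> invertible (W t))"

definition C1_from :: "real \<Rightarrow> (real \<Rightarrow> 'a::real_normed_vector) \<Rightarrow> bool" where
  "C1_from t0 A \<longleftrightarrow>
     (\<exists>A'. (\<forall>t\<ge>t0. (A has_vector_derivative A' t) (at t within {t0..})) \<and> continuous_on {t0..} A')"

text \<open>Exponential stability of the zero solution of \<open>x' = g t x\<close> on \<open>[t0, \<infinity>)\<close>. As usual for
  nonautonomous equations the constants do not depend on the starting time \<open>s \<ge> t0\<close>; the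
  case \<open>s = t0\<close> is the estimate for the solutions started at \<open>t0\<close>.\<close>

definition zero_exponentially_stable ::
  "(real \<Rightarrow> 'a::real_normed_vector \<Rightarrow> 'a) \<Rightarrow> real \<Rightarrow> bool" where
  "zero_exponentially_stable g t0 \<longleftrightarrow>
     (\<exists>\<delta>>0. \<exists>C>0. \<exists>\<gamma>>0. \<forall>s\<ge>t0. \<forall>x0 x.
        norm x0 < \<delta> \<and> ivp_solution g s x0 x \<longrightarrow>
          (\<forall>t\<ge>s. norm (x t) \<le> C * norm x0 * exp (- \<gamma> * (t - s))))"

end

theory Submission
  imports Defs
begin

text \<open>
  The substitution \<open>x = W z\<close> removes the linear part: a solution of
  \<open>x' = A x + f(t,x) + F\<close> turns into a solution of \<open>z' = W\<^sup>-\<^sup>1 (f(t,x) + F)\<close>.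
  While \<open>x\<close> stays in the ball where \<open>\<parallel>f(t,x)\<parallel> \<le> l \<parallel>x\<parallel>\<close>, this gives
  \<open>\<parallel>z'\<parallel> \<le> \<parallel>W\<^sup>-\<^sup>1\<parallel> (l \<parallel>W\<parallel> \<parallel>z\<parallel> + \<parallel>F\<parallel>)\<close>. Since \<open>p\<close> is the logarithmic
  derivative of \<open>\<parallel>W\<parallel>\<close> and \<open>k = \<parallel>W\<parallel> \<parallel>W\<^sup>-\<^sup>1\<parallel>\<close>, the quantity \<open>\<parallel>W\<parallel> \<parallel>z\<parallel>\<close>, which
  dominates \<open>\<parallel>x\<parallel>\<close>, is controlled by the scalar equation
  \<open>R' = (p + k l) R + k \<parallel>F\<parallel>\<close>.

  Any supersolution \<open>R\<close> of that equation that starts above \<open>k(s) \<parallel>x(s)\<parallel>\<close> and never exceeds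
  the radius of the ball therefore bounds \<open>\<parallel>x\<parallel>\<close> for all time
  (\<open>ivp_solution_below_barrier\<close>). The proof stops at the first time at which \<open>\<parallel>z\<parallel>\<close> meets
  \<open>R / \<parallel>W\<parallel>\<close> (\<open>norm_less_if_derivative_bounded_below_barrier\<close>); up to that time the bound
  itself keeps \<open>x\<close> inside the ball, so no separate argument is needed for that, and the
  variation of constants formula and Gronwall's inequality are both avoided.

  Supersolutions come from a nondecreasing function \<open>\<Gamma>\<close> with \<open>\<Gamma>' \<ge> p + k l + v\<^sub>1\<close> and bounded
  total growth, which exists because \<open>p + k l \<le> - v\<^sub>1\<close> after \<open>t\<^sub>1\<close>
  (\<open>eventually_negative_majorant\<close>). For \<open>F = 0\<close> the choice
  \<open>R(t) = c exp (\<Gamma>(t) - \<Gamma>(s) - v\<^sub>1 (t - s))\<close> decays exponentially, uniformly in the initial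
  time \<open>s\<close>. For a small forcing \<open>F\<close> the choice \<open>R(t) = c exp (\<Gamma>(t) - \<Gamma>(t\<^sub>0))\<close> stays bounded,
  and its surplus \<open>v\<^sub>1 R \<ge> v\<^sub>1 c\<close> absorbs \<open>k \<parallel>F\<parallel>\<close>.
\<close>

section \<open>The spectral norm and the inverse matrix\<close>

lemma norm_mult_le_spec_norm: "norm (M *v x) \<le> spec_norm M * norm x"
  unfolding spec_norm_def by (rule onorm[OF matrix_vector_mul_bounded_linear])

lemma spec_norm_nonneg: "0 \<le> spec_norm M"
  unfolding spec_norm_def by (rule onorm_pos_le[OF matrix_vector_mul_bounded_linear])

lemma
  fixes M :: "real^'n^'n"
  assumes "invertible M"
  shows mult_matrix_inv_cancel: "M *v (matrix_inv M *v x) = x"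
    and matrix_inv_mult_cancel: "matrix_inv M *v (M *v x) = x"
proof -
  have "M ** matrix_inv M = mat 1 \<and> matrix_inv M ** M = mat 1"
    unfolding matrix_inv_def by (rule someI_ex) (use assms in \<open>auto simp: invertible_def\<close>)
  then show "M *v (matrix_inv M *v x) = x" "matrix_inv M *v (M *v x) = x"
    by (simp_all add: matrix_vector_mul_assoc)
qed

lemma spec_norm_pos:
  fixes M :: "real^'n^'n"
  assumes "invertible M"
  shows "0 < spec_norm M"
proof -
  obtain x :: "real^'n" where "norm x = 1"
    using vector_choose_size[of 1] by auto
  then have "M *v x \<noteq> 0"
    using matrix_inv_mult_cancel[OF assms, of x] by auto
  then show ?thesis
    unfolding spec_norm_def onorm_pos_lt[OF matrix_vector_mul_bounded_linear] by blast
qed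

lemma bounded_bilinear_matrix_vector_mult:
  "bounded_bilinear (\<lambda>(M::real^'n^'m) x. M *v x)"
  unfolding bilinear_conv_bounded_bilinear[symmetric] bilinear_def
  by (auto intro!: linearI simp: matrix_vector_right_distrib matrix_vector_mult_add_rdistrib
      matrix_vector_mult_scaleR scaleR_matrix_vector_assoc)

text \<open>
  With \<open>z = W\<^sub>0\<^sup>-\<^sup>1 u\<^sub>0\<close> one has \<open>W\<^sup>-\<^sup>1 u - z = W\<^sup>-\<^sup>1 (u - W z)\<close>, where \<open>u - W z\<close> tends to \<open>0\<close>
  and convergence of the norms keeps \<open>W\<^sup>-\<^sup>1\<close> bounded. Along a fundamental matrix the norms
  \<open>\<parallel>W\<^sup>-\<^sup>1\<parallel> = k / \<parallel>W\<parallel>\<close> converge because the condition number \<open>k\<close> is continuous.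
\<close>

lemma tendsto_matrix_inv_mult:
  fixes W :: "'b \<Rightarrow> real^'n^'n"
  assumes W: "(W \<longlongrightarrow> W0) F" and inv0: "invertible W0"
    and inv: "eventually (\<lambda>t. invertible (W t)) F"
    and nrm: "((\<lambda>t. spec_norm (matrix_inv (W t))) \<longlongrightarrow> b) F"
    and u: "(u \<longlongrightarrow> u0) F"
  shows "((\<lambda>t. matrix_inv (W t) *v u t) \<longlongrightarrow> matrix_inv W0 *v u0) F"
proof -
  define z where "z = matrix_inv W0 *v u0"
  have "((\<lambda>t. W t *v z) \<longlongrightarrow> W0 *v z) F"
    by (rule bounded_bilinear.tendsto[OF bounded_bilinear_matrix_vector_mult W tendsto_const])
  then have "((\<lambda>t. u t - W t *v z) \<longlongrightarrow> u0 - W0 *v z) F"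
    by (intro tendsto_diff u)
  then have "((\<lambda>t. spec_norm (matrix_inv (W t)) * norm (u t - W t *v z)) \<longlongrightarrow> b * norm (u0 - W0 *v z)) F"
    by (intro tendsto_mult nrm tendsto_norm)
  then have lim: "((\<lambda>t. spec_norm (matrix_inv (W t)) * norm (u t - W t *v z)) \<longlongrightarrow> 0) F"
    by (simp add: z_def mult_matrix_inv_cancel[OF inv0])
  have "eventually (\<lambda>t. norm (matrix_inv (W t) *v u t - z)
      \<le> spec_norm (matrix_inv (W t)) * norm (u t - W t *v z)) F"
    using inv
  proof eventually_elim
    case (elim t)
    have "matrix_inv (W t) *v u t - z = matrix_inv (W t) *v (u t - W t *v z)"
      by (simp add: matrix_vector_mult_diff_distrib matrix_inv_mult_cancel[OF elim])
    then show ?case by (simp add: norm_mult_le_spec_norm)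
  qed
  then have "((\<lambda>t. matrix_inv (W t) *v u t - z) \<longlongrightarrow> 0) F"
    by (rule Lim_null_comparison[OF _ lim])
  then show ?thesis unfolding z_def by (simp add: LIM_zero_iff)
qed

lemma has_vector_derivative_iff_slope:
  "(f has_vector_derivative d) (at x within S) \<longleftrightarrow>
    ((\<lambda>y. (f y - f x) /\<^sub>R (y - x)) \<longlongrightarrow> d) (at x within S)"
proof -
  have "((\<lambda>y. (1 / norm (y - x)) *\<^sub>R (f y - (f x + (y - x) *\<^sub>R d))) \<longlongrightarrow> 0) (at x within S) \<longleftrightarrow>
      ((\<lambda>y. norm ((1 / norm (y - x)) *\<^sub>R (f y - (f x + (y - x) *\<^sub>R d)))) \<longlongrightarrow> 0) (at x within S)"
    by (simp only: tendsto_norm_zero_iff)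
  also have "\<dots> \<longleftrightarrow> ((\<lambda>y. norm ((f y - f x) /\<^sub>R (y - x) - d)) \<longlongrightarrow> 0) (at x within S)"
  proof (rule filterlim_cong[OF refl refl])
    have "norm ((1 / norm (y - x)) *\<^sub>R (f y - (f x + (y - x) *\<^sub>R d)))
        = norm ((f y - f x) /\<^sub>R (y - x) - d)" if "y \<noteq> x" for y
    proof -
      have "(f y - f x) /\<^sub>R (y - x) - d = (f y - (f x + (y - x) *\<^sub>R d)) /\<^sub>R (y - x)"
        using that by (simp add: diff_diff_eq[symmetric] scaleR_diff_right[of _ "f y - f x"])
      then show ?thesis using that by (simp add: divide_inverse)
    qed
    then show "\<forall>\<^sub>F y in at x within S. norm ((1 / norm (y - x)) *\<^sub>R (f y - (f x + (y - x) *\<^sub>R d)))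
        = norm ((f y - f x) /\<^sub>R (y - x) - d)"
      by (auto simp: eventually_at_filter)
  qed
  also have "\<dots> \<longleftrightarrow> ((\<lambda>y. (f y - f x) /\<^sub>R (y - x)) \<longlongrightarrow> d) (at x within S)"
    by (simp add: tendsto_norm_zero_iff LIM_zero_iff)
  finally show ?thesis
    by (simp add: has_vector_derivative_def has_derivative_within bounded_linear_scaleR_left)
qed

text \<open>
  Differentiating \<open>z = W\<^sup>-\<^sup>1 x\<close> directly does without a derivative of the matrix inverse:
  the increments satisfy \<open>z(t) - z(\<tau>) = W(t)\<^sup>-\<^sup>1 (x(t) - x(\<tau>) - (W(t) - W(\<tau>)) z(\<tau>))\<close>, so the
  difference quotient of \<open>z\<close> has the form treated in \<open>tendsto_matrix_inv_mult\<close>.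
\<close>

lemma has_vector_derivative_matrix_inv_mult:
  fixes W :: "real \<Rightarrow> real^'n^'n"
  assumes W: "(W has_vector_derivative W') (at \<tau> within S)"
    and x: "(x has_vector_derivative x') (at \<tau> within S)"
    and inv: "\<And>t. t \<in> S \<Longrightarrow> invertible (W t)" and "\<tau> \<in> S"
    and nrm: "((\<lambda>t. spec_norm (matrix_inv (W t))) \<longlongrightarrow> b) (at \<tau> within S)"
  shows "((\<lambda>t. matrix_inv (W t) *v x t) has_vector_derivative
      matrix_inv (W \<tau>) *v (x' - W' *v (matrix_inv (W \<tau>) *v x \<tau>))) (at \<tau> within S)"
  unfolding has_vector_derivative_iff_slope
proof -
  define z where "z t = matrix_inv (W t) *v x t" for t
  have "((\<lambda>t. (x t - x \<tau>) /\<^sub>R (t - \<tau>) - ((W t - W \<tau>) /\<^sub>R (t - \<tau>)) *v z \<tau>) \<longlongrightarrow> x' - W' *v z \<tau>)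
      (at \<tau> within S)"
    by (intro tendsto_diff bounded_bilinear.tendsto[OF bounded_bilinear_matrix_vector_mult]
        tendsto_const x[unfolded has_vector_derivative_iff_slope] W[unfolded has_vector_derivative_iff_slope])
  then have "((\<lambda>t. matrix_inv (W t) *v ((x t - x \<tau>) /\<^sub>R (t - \<tau>) - ((W t - W \<tau>) /\<^sub>R (t - \<tau>)) *v z \<tau>)) \<longlongrightarrow>
      matrix_inv (W \<tau>) *v (x' - W' *v z \<tau>)) (at \<tau> within S)"
    by (intro tendsto_matrix_inv_mult[OF _ _ _ nrm])
      (use has_vector_derivative_continuous[OF W] inv \<open>\<tau> \<in> S\<close> in
        \<open>auto simp: continuous_within eventually_at_filter\<close>)
  moreover have "\<forall>\<^sub>F t in at \<tau> within S.
      matrix_inv (W t) *v ((x t - x \<tau>) /\<^sub>R (t - \<tau>) - ((W t - W \<tau>) /\<^sub>R (t - \<tau>)) *v z \<tau>)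
      = (z t - z \<tau>) /\<^sub>R (t - \<tau>)"
  proof -
    have "matrix_inv (W t) *v ((x t - x \<tau>) /\<^sub>R (t - \<tau>) - ((W t - W \<tau>) /\<^sub>R (t - \<tau>)) *v z \<tau>)
      = (z t - z \<tau>) /\<^sub>R (t - \<tau>)" if "t \<in> S" for t
    proof -
      have "(x t - x \<tau>) /\<^sub>R (t - \<tau>) - ((W t - W \<tau>) /\<^sub>R (t - \<tau>)) *v z \<tau>
          = (x t - x \<tau> - (W t - W \<tau>) *v z \<tau>) /\<^sub>R (t - \<tau>)"
        by (simp only: scaleR_matrix_vector_assoc scaleR_diff_right[of _ "x t - x \<tau>"])
      also have "x t - x \<tau> - (W t - W \<tau>) *v z \<tau> = x t - W t *v z \<tau>"
        by (simp add: matrix_vector_mult_diff_rdistrib z_def mult_matrix_inv_cancel inv \<open>\<tau> \<in> S\<close>)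
      finally show ?thesis
        by (simp add: matrix_vector_mult_scaleR matrix_vector_mult_diff_distrib
            matrix_inv_mult_cancel inv that z_def)
    qed
    then show ?thesis by (auto simp: eventually_at_filter)
  qed
  ultimately have "((\<lambda>t. (z t - z \<tau>) /\<^sub>R (t - \<tau>)) \<longlongrightarrow>
      matrix_inv (W \<tau>) *v (x' - W' *v z \<tau>)) (at \<tau> within S)"
    by (simp only: filterlim_cong[OF refl refl])
  then show "((\<lambda>t. (matrix_inv (W t) *v x t - matrix_inv (W \<tau>) *v x \<tau>) /\<^sub>R (t - \<tau>)) \<longlongrightarrow>
      matrix_inv (W \<tau>) *v (x' - W' *v (matrix_inv (W \<tau>) *v x \<tau>))) (at \<tau> within S)"
    by (simp add: z_def)
qed

section \<open>Comparison with scalar functions\<close>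

text \<open>
  At a first time \<open>T\<close> with \<open>\<parallel>z(T)\<parallel> \<ge> \<rho>(T)\<close> the derivative bound holds on all of \<open>(s,T)\<close>, so
  \<open>\<parallel>z(T)\<parallel> \<le> \<parallel>z(s)\<parallel> + \<rho>(T) - \<rho>(s) < \<rho>(T)\<close> by the mean value inequality. The bound on
  \<open>z'\<close> is only required as long as \<open>z\<close> lies below \<open>\<rho>\<close>, which is what makes the lemma
  usable with the estimate of \<open>f\<close> that holds merely near \<open>0\<close>.
\<close>

lemma norm_less_if_derivative_bounded_below_barrier:
  fixes z :: "real \<Rightarrow> 'a::real_normed_vector"
  assumes dz: "\<And>t. t \<ge> s \<Longrightarrow> (z has_vector_derivative z' t) (at t within {s..})"
    and dr: "\<And>t. t \<ge> s \<Longrightarrow> (\<rho> has_real_derivative \<rho>' t) (at t within {s..})"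
    and init: "norm (z s) < \<rho> s"
    and step: "\<And>t. t \<ge> s \<Longrightarrow> norm (z t) \<le> \<rho> t \<Longrightarrow> norm (z' t) \<le> \<rho>' t"
    and "t \<ge> s"
  shows "norm (z t) < \<rho> t"
proof (rule ccontr)
  assume neg: "\<not> norm (z t) < \<rho> t"
  have cz: "continuous_on {s..} z"
    using has_vector_derivative_continuous[OF dz] by (auto simp: continuous_on_eq_continuous_within)
  have cr: "continuous_on {s..} \<rho>"
    using DERIV_continuous[OF dr] by (auto simp: continuous_on_eq_continuous_within)
  define C where "C = {u \<in> {s..}. \<rho> u \<le> norm (z u)}"
  have "closed C"
    unfolding C_def by (intro continuous_on_closed_Collect_le continuous_on_norm cz cr closed_atLeast)
  moreover have "t \<in> C" and bdd: "bdd_below C"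
    using neg \<open>t \<ge> s\<close> by (auto simp: C_def intro!: bdd_belowI[of _ s])
  ultimately have T: "Inf C \<in> C" by (intro closed_contains_Inf) auto
  define T where "T = Inf C"
  have T: "s \<le> T" "\<rho> T \<le> norm (z T)" using T by (auto simp: C_def T_def)
  have below: "norm (z u) < \<rho> u" if "s \<le> u" "u < T" for u
    using that cInf_lower[OF _ bdd, of u] by (force simp: C_def T_def)
  have "s < T" using T init by (cases "s = T") auto
  then have "norm (z T - z s) \<le> \<rho> T - \<rho> s"
  proof (rule differentiable_bound_general)
    show "continuous_on {s..T} z" "continuous_on {s..T} \<rho>"
      using cz cr by (auto elim: continuous_on_subset)
    fix u assume u: "s < u" "u < T"
    have at: "at u within {s..} = at u"
      using u by (intro at_within_interior) auto
    show "(z has_vector_derivative z' u) (at u)" using dz[of u] u at by simp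
    show "(\<rho> has_vector_derivative \<rho>' u) (at u)"
      using dr[of u] u at by (simp add: has_real_derivative_iff_has_vector_derivative)
    show "norm (z' u) \<le> \<rho>' u" using step[of u] below[of u] u by simp
  qed
  moreover have "norm (z T) \<le> norm (z T - z s) + norm (z s)"
    using norm_triangle_ineq[of "z T - z s" "z s"] by simp
  ultimately show False using T init by simp
qed

lemma antiderivative_from:
  fixes g :: "real \<Rightarrow> real"
  assumes "continuous_on {a..} g"
  obtains G where "\<And>t. t \<ge> a \<Longrightarrow> (G has_real_derivative g t) (at t within {a..})"
proof
  fix t assume "t \<ge> a"
  have "((\<lambda>u. integral {a..u} g) has_vector_derivative g t) (at t within {a..t+1})"
    by (rule integral_has_vector_derivative)
      (use \<open>t \<ge> a\<close> assms in \<open>auto elim: continuous_on_subset\<close>)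
  moreover have "at t within {a..t+1} = at t within {a..}"
    by (rule at_within_nhd[of _ "{..<t+1}"]) auto
  ultimately show "((\<lambda>u. integral {a..u} g) has_real_derivative g t) (at t within {a..})"
    by (simp add: has_real_derivative_iff_has_vector_derivative)
qed

lemma mono_of_derivative_nonneg:
  fixes G :: "real \<Rightarrow> real"
  assumes d: "\<And>t. t \<ge> a \<Longrightarrow> (G has_real_derivative g t) (at t within {a..})"
    and nn: "\<And>t. t > a \<Longrightarrow> 0 \<le> g t" and "a \<le> u" "u \<le> w"
  shows "G u \<le> G w"
proof (cases "u = w")
  case False
  have "continuous_on {a..} G"
    using DERIV_continuous[OF d] by (auto simp: continuous_on_eq_continuous_within)
  then have "continuous_on {u..w} G"
    using \<open>a \<le> u\<close> by (auto elim: continuous_on_subset)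
  moreover have "\<exists>y. (G has_real_derivative y) (at t) \<and> y \<ge> 0" if "u < t" "t < w" for t
  proof -
    have "at t within {a..} = at t" using that \<open>a \<le> u\<close> by (intro at_within_interior) auto
    then show ?thesis using d[of t] nn[of t] that \<open>a \<le> u\<close> by auto
  qed
  ultimately show ?thesis
    using DERIV_nonneg_imp_increasing_open[of u w G] \<open>u \<le> w\<close> by blast
qed simp

section \<open>Barriers for the perturbed equation\<close>

text \<open>
  This is the comparison lemma for \<open>z = W\<^sup>-\<^sup>1 x\<close> and \<open>\<rho> = R / \<parallel>W\<parallel>\<close>. Division by \<open>\<parallel>W\<parallel>\<close> turns
  \<open>R'\<close> into \<open>R' - p R\<close>, which accounts for \<open>p\<close> in the condition on \<open>R'\<close>, and the factor
  \<open>\<parallel>W\<^sup>-\<^sup>1\<parallel> = k / \<parallel>W\<parallel>\<close> in \<open>z'\<close> accounts for \<open>k\<close>; the same factor in \<open>z(s)\<close> is the reason for the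
  condition number in the condition on \<open>R(s)\<close>.
\<close>

lemma ivp_solution_below_barrier:
  fixes A :: "real \<Rightarrow> real^'n^'n"
  assumes W: "fundamental_matrix A t0 W"
    and p: "\<forall>t\<ge>t0. ((\<lambda>s. ln (spec_norm (W s))) has_real_derivative p t) (at t within {t0..})"
    and k: "continuous_on {t0..} (\<lambda>t. cond_number (W t))"
    and f: "\<And>t x. t \<ge> t0 \<Longrightarrow> norm x \<le> r \<Longrightarrow> norm (f t x) \<le> l t * norm x"
    and l: "\<And>t. t \<ge> t0 \<Longrightarrow> 0 \<le> l t"
    and "s \<ge> t0"
    and sol: "ivp_solution (\<lambda>t x. A t *v x + f t x + F t) s x0 x"
    and R: "\<And>t. t \<ge> s \<Longrightarrow> (R has_real_derivative R' t) (at t within {s..})"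
    and Rr: "\<And>t. t \<ge> s \<Longrightarrow> R t \<le> r"
    and init: "cond_number (W s) * norm x0 < R s"
    and super: "\<And>t. t \<ge> s \<Longrightarrow>
      (p t + cond_number (W t) * l t) * R t + cond_number (W t) * norm (F t) \<le> R' t"
    and "t \<ge> s"
  shows "norm (x t) \<le> R t"
proof -
  define w where "w t = spec_norm (W t)" for t
  define v where "v t = spec_norm (matrix_inv (W t))" for t
  define z where "z t = matrix_inv (W t) *v x t" for t
  define \<rho> where "\<rho> t = R t / w t" for t
  have inv: "invertible (W t)" if "t \<ge> t0" for t using W that by (auto simp: fundamental_matrix_def)
  have wpos: "w t > 0" if "t \<ge> t0" for t using spec_norm_pos[OF inv[OF that]] by (simp add: w_def)
  have kwv: "cond_number (W t) = w t * v t" for t by (simp add: cond_number_def w_def v_def)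
  have v0: "0 \<le> v t" for t by (simp add: v_def spec_norm_nonneg)
  have xz: "x t = W t *v z t" if "t \<ge> t0" for t
    by (simp add: z_def mult_matrix_inv_cancel[OF inv[OF that]])
  have xs: "x s = x0" and dx: "\<And>t. t \<ge> s \<Longrightarrow>
      (x has_vector_derivative A t *v x t + f t (x t) + F t) (at t within {s..})"
    using sol by (auto simp: ivp_solution_def)
  have sub: "{s..} \<subseteq> {t0..}" using \<open>s \<ge> t0\<close> by auto
  have dw: "(w has_real_derivative p t * w t) (at t within {s..})" if "t \<ge> s" for t
  proof -
    have "((\<lambda>u. exp (ln (w u))) has_real_derivative exp (ln (w t)) * p t) (at t within {s..})"
      unfolding w_def
      by (intro DERIV_chain2[OF DERIV_exp] DERIV_subset[OF p[rule_format] sub])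
        (use that \<open>s \<ge> t0\<close> in auto)
    then have "((\<lambda>u. exp (ln (w u))) has_real_derivative p t * w t) (at t within {s..})"
      using wpos[of t] that \<open>s \<ge> t0\<close> by (simp add: mult.commute)
    then show ?thesis
      by (rule has_field_derivative_transform_within[where d = 1])
        (use that wpos \<open>s \<ge> t0\<close> in auto)
  qed
  have vlim: "(v \<longlongrightarrow> cond_number (W t) / w t) (at t within {s..})" if "t \<ge> s" for t
  proof -
    have "((\<lambda>u. cond_number (W u)) \<longlongrightarrow> cond_number (W t)) (at t within {s..})"
      using continuous_on_subset[OF k sub] that by (auto simp: continuous_on_def)
    moreover have "(w \<longlongrightarrow> w t) (at t within {s..})"
      using DERIV_continuous[OF dw[OF that]] by (simp add: continuous_within)
    ultimately have "((\<lambda>u. cond_number (W u) / w u) \<longlongrightarrow> cond_number (W t) / w t) (at t within {s..})"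
      using wpos[of t] that \<open>s \<ge> t0\<close> by (intro tendsto_divide) auto
    moreover have "cond_number (W u) / w u = v u" if "u \<in> {s..}" for u
      using wpos[of u] that \<open>s \<ge> t0\<close> by (simp add: kwv)
    ultimately show ?thesis
      by (elim Lim_transform_eventually) (auto simp: eventually_at_filter)
  qed
  have "norm (z t) < \<rho> t"
  proof (rule norm_less_if_derivative_bounded_below_barrier[where z = z and \<rho> = \<rho> and s = s])
    fix t assume t: "t \<ge> s"
    have t0: "t \<ge> t0" using t \<open>s \<ge> t0\<close> by simp
    have "(W has_vector_derivative A t ** W t) (at t within {s..})"
      using W t0 sub by (auto simp: fundamental_matrix_def intro: has_vector_derivative_within_subset)
    then have "(z has_vector_derivative
        matrix_inv (W t) *v (A t *v x t + f t (x t) + F t - (A t ** W t) *v z t)) (at t within {s..})"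
      unfolding z_def
      by (rule has_vector_derivative_matrix_inv_mult[OF _ dx[OF t] _ _ vlim[OF t, unfolded v_def[abs_def]]])
        (use t inv \<open>s \<ge> t0\<close> in auto)
    moreover have "A t *v x t + f t (x t) + F t - (A t ** W t) *v z t = f t (x t) + F t"
      by (simp add: matrix_vector_mul_assoc[symmetric] xz[OF t0, symmetric])
    ultimately show "(z has_vector_derivative matrix_inv (W t) *v (f t (x t) + F t)) (at t within {s..})"
      by simp
    show "(\<rho> has_real_derivative (R' t - p t * R t) / w t) (at t within {s..})"
      unfolding \<rho>_def using wpos[OF t0]
      by (auto intro!: derivative_eq_intros R dw t simp: field_simps)
    assume zr: "norm (z t) \<le> \<rho> t"
    have "norm (x t) \<le> w t * norm (z t)"
      using norm_mult_le_spec_norm[of "W t" "z t"] xz[OF t0] by (simp add: w_def)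
    also have "\<dots> \<le> w t * \<rho> t" using zr wpos[OF t0] by simp
    also have "\<dots> = R t" using wpos[OF t0] by (simp add: \<rho>_def)
    finally have xR: "norm (x t) \<le> R t" .
    have "norm (matrix_inv (W t) *v (f t (x t) + F t)) \<le> v t * norm (f t (x t) + F t)"
      unfolding v_def by (rule norm_mult_le_spec_norm)
    also have "norm (f t (x t) + F t) \<le> l t * norm (x t) + norm (F t)"
      using f[OF t0, of "x t"] xR Rr[OF t] norm_triangle_ineq[of "f t (x t)" "F t"] by linarith
    also have "\<dots> \<le> l t * R t + norm (F t)"
      using mult_left_mono[OF xR l[OF t0]] by simp
    finally have "norm (matrix_inv (W t) *v (f t (x t) + F t)) \<le> v t * (l t * R t + norm (F t))"
      using v0[of t] by (simp add: mult_left_mono)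
    also have "\<dots> \<le> (R' t - p t * R t) / w t"
      using super[OF t] wpos[OF t0] by (simp add: kwv field_simps)
    finally show "norm (matrix_inv (W t) *v (f t (x t) + F t)) \<le> (R' t - p t * R t) / w t" .
  next
    have "norm (z s) \<le> v s * norm x0"
      unfolding z_def v_def xs[symmetric] by (rule norm_mult_le_spec_norm)
    also have "\<dots> < \<rho> s"
      using init wpos[OF \<open>s \<ge> t0\<close>] by (simp add: kwv \<rho>_def field_simps)
    finally show "norm (z s) < \<rho> s" .
  qed (rule \<open>t \<ge> s\<close>)
  moreover have "t \<ge> t0" using \<open>t \<ge> s\<close> \<open>s \<ge> t0\<close> by simp
  moreover have "norm (x t) \<le> w t * norm (z t)"
    using norm_mult_le_spec_norm[of "W t" "z t"] xz[OF \<open>t \<ge> t0\<close>] by (simp add: w_def)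
  ultimately show ?thesis
    using wpos[of t] by (simp add: \<rho>_def field_simps)
qed

text \<open>
  The rate \<open>\<gamma> = max 0 (g + v)\<close> vanishes after \<open>t\<^sub>1\<close>, so its antiderivative \<open>\<Gamma>\<close> gains at most
  \<open>\<Gamma>(t\<^sub>1) - \<Gamma>(t\<^sub>0)\<close> over any interval, wherever the interval starts. This is where the
  stability constants get their independence of the initial time.
\<close>

lemma eventually_negative_majorant:
  fixes g :: "real \<Rightarrow> real"
  assumes g: "continuous_on {t0..} g" and "t1 \<ge> t0" and neg: "\<And>t. t > t1 \<Longrightarrow> g t \<le> - v"
  obtains \<Gamma> \<gamma> N where
    "\<And>t. t \<ge> t0 \<Longrightarrow> (\<Gamma> has_real_derivative \<gamma> t) (at t within {t0..})"
    "\<And>t. t \<ge> t0 \<Longrightarrow> g t + v \<le> \<gamma> t"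
    "\<And>s t. t0 \<le> s \<Longrightarrow> s \<le> t \<Longrightarrow> \<Gamma> s \<le> \<Gamma> t" "\<And>s t. t0 \<le> s \<Longrightarrow> s \<le> t \<Longrightarrow> \<Gamma> t - \<Gamma> s \<le> N"
proof -
  define \<gamma> where "\<gamma> t = max 0 (g t + v)" for t
  have "continuous_on {t0..} \<gamma>" unfolding \<gamma>_def by (intro continuous_intros g)
  then obtain \<Gamma> where d: "\<And>t. t \<ge> t0 \<Longrightarrow> (\<Gamma> has_real_derivative \<gamma> t) (at t within {t0..})"
    using antiderivative_from by blast
  have mono: "\<Gamma> s \<le> \<Gamma> t" if "t0 \<le> s" "s \<le> t" for s t
    using mono_of_derivative_nonneg[OF d] that by (simp add: \<gamma>_def)
  have le: "\<Gamma> t \<le> \<Gamma> t1" if "t \<ge> t0" for t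
  proof (cases "t \<ge> t1")
    case True
    have "((\<lambda>u. - \<Gamma> u) has_real_derivative - \<gamma> u) (at u within {t1..})" if "u \<ge> t1" for u
      using that \<open>t1 \<ge> t0\<close> by (intro derivative_intros DERIV_subset[OF d]) auto
    then have "- \<Gamma> t1 \<le> - \<Gamma> t"
      by (rule mono_of_derivative_nonneg) (use neg True in \<open>force simp: \<gamma>_def\<close>)+
    then show ?thesis by simp
  qed (use mono that in simp)
  show ?thesis
  proof (rule that[OF d])
    show "\<Gamma> t - \<Gamma> s \<le> \<Gamma> t1 - \<Gamma> t0" if "t0 \<le> s" "s \<le> t" for s t
      using le[of t] mono[of t0 s] that by simp
  qed (use mono in \<open>auto simp: \<gamma>_def\<close>)
qed

theorem corollary2:
  fixes A :: "real \<Rightarrow> real^'n^'n"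
    and f :: "real \<Rightarrow> real^'n \<Rightarrow> real^'n"
    and W :: "real \<Rightarrow> real^'n^'n"
    and p l :: "real \<Rightarrow> real"
    and \<Omega> :: "(real^'n) set"
    and t0 t1 v1 lhat sigma_bar sigma_low :: real
  assumes "continuous_on {t0..} A" and "bounded (A ` {t0..})" and "C1_from t0 A"
    and "continuous_on ({t0..} \<times> UNIV) (\<lambda>(t, x). f t x)"
    and "bounded ((\<lambda>(t, x). f t x) ` ({t0..} \<times> UNIV))"
    and "\<forall>t\<ge>t0. f t 0 = 0"
    and "ivp_uniquely_solvable (\<lambda>t x. A t *v x + f t x) t0"
    and "fundamental_matrix A t0 W" and "spec_norm (W t0) = 1"
    and "\<forall>t\<ge>t0. simple_singular_value (W t) (sigma_max (W t))"
    and "\<forall>t\<ge>t0. sigma_max (W t) \<le> sigma_bar"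
    and "\<forall>t\<ge>t0. sigma_low \<le> sigma_min (W t)"
    and "\<forall>t\<ge>t0. ((\<lambda>s. ln (spec_norm (W s))) has_real_derivative p t) (at t within {t0..})"
    and "continuous_on {t0..} p"
    and "continuous_on {t0..} (\<lambda>t. cond_number (W t))"
    and "bounded ((\<lambda>t. cond_number (W t)) ` {t0..})"
    and "0 \<in> interior \<Omega>"
    and "\<forall>t\<ge>t0. \<forall>x\<in>\<Omega>. norm (f t x) \<le> l t * norm x"
    and "continuous_on {t0..} l" and "\<forall>t\<ge>t0. l t \<le> lhat"
    and "v1 > 0" and "t1 \<ge> t0"
    and "(SUP t\<in>{t1<..}. ereal (p t + cond_number (W t) * l t)) < ereal (- v1)"
  shows "zero_exponentially_stable (\<lambda>t x. A t *v x + f t x) t0 \<and>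
    (\<exists>\<epsilon>>0. \<exists>\<delta>>0. \<forall>F F0 x0 x.
       continuous_on {t0..} F \<and> bounded (F ` {t0..}) \<and>
       ivp_uniquely_solvable (\<lambda>t x. A t *v x + f t x + F t) t0 \<and>
       (\<forall>t\<ge>t0. norm (F t) \<le> F0) \<and> F0 \<le> \<epsilon> \<and> norm x0 \<le> \<delta> \<and>
       ivp_solution (\<lambda>t x. A t *v x + f t x + F t) t0 x0 x
       \<longrightarrow> bounded (x ` {t0..}))"
proof -
  note W = assms(8) and p = assms(13) and kc = assms(15)
  define k where "k t = cond_number (W t)" for t
  define g where "g t = p t + k t * l t" for t
  have k0: "0 \<le> k t" for t by (simp add: k_def cond_number_def spec_norm_nonneg)
  obtain K where "K > 0" and K: "\<And>t. t \<ge> t0 \<Longrightarrow> k t \<le> K"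
    using assms(16) unfolding bounded_pos k_def by (force simp: image_iff abs_le_iff)
  obtain r where "r > 0" and r: "cball 0 r \<subseteq> \<Omega>"
    using assms(17) by (auto simp: mem_interior_cball)
  have f: "norm (f t x) \<le> l t * norm x" if "t \<ge> t0" "norm x \<le> r" for t x
    using assms(18) that r by (auto simp: subset_iff)
  \<comment> \<open>\<open>l t * r\<close> bounds a norm, and there are vectors of norm \<open>r\<close>.\<close>
  have l: "0 \<le> l t" if "t \<ge> t0" for t
  proof -
    obtain x :: "real^'n" where "norm x = r" using vector_choose_size[of r] \<open>r > 0\<close> by auto
    then have "0 \<le> l t * r" using order_trans[OF norm_ge_zero f[OF that, of x]] by simp
    then show ?thesis using \<open>r > 0\<close> by (simp add: zero_le_mult_iff)
  qed
  have "continuous_on {t0..} g"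
    unfolding g_def k_def by (intro continuous_intros assms)
  moreover have "g t \<le> - v1" if "t > t1" for t
  proof -
    have "ereal (g t) \<le> (SUP t\<in>{t1<..}. ereal (p t + cond_number (W t) * l t))"
      unfolding g_def k_def using that by (intro SUP_upper) auto
    then have "ereal (g t) < ereal (- v1)" using assms(23) by (rule le_less_trans)
    then show ?thesis by simp
  qed
  ultimately obtain \<Gamma> \<gamma> N where d: "\<And>t. t \<ge> t0 \<Longrightarrow> (\<Gamma> has_real_derivative \<gamma> t) (at t within {t0..})"
    and \<gamma>: "\<And>t. t \<ge> t0 \<Longrightarrow> g t + v1 \<le> \<gamma> t"
    and mono: "\<And>s t. t0 \<le> s \<Longrightarrow> s \<le> t \<Longrightarrow> \<Gamma> s \<le> \<Gamma> t"
    and N: "\<And>s t. t0 \<le> s \<Longrightarrow> s \<le> t \<Longrightarrow> \<Gamma> t - \<Gamma> s \<le> N"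
    using eventually_negative_majorant[of t0 g t1 v1] \<open>t1 \<ge> t0\<close> by blast
  define B where "B = exp N"
  have "B > 0" by (simp add: B_def)
  define R where "R c \<theta> s t = c * exp (\<Gamma> t - \<Gamma> s - \<theta> * (t - s))" for c \<theta> s t
  have dR: "(R c \<theta> s has_real_derivative (\<gamma> t - \<theta>) * R c \<theta> s t) (at t within {s..})"
    if "t0 \<le> s" "s \<le> t" for c \<theta> s t
    unfolding R_def
    by (rule derivative_eq_intros refl DERIV_subset[OF d] | use that in \<open>force simp: algebra_simps\<close>)+
  have R_le: "R c \<theta> s t \<le> c * B * exp (- \<theta> * (t - s))" if "t0 \<le> s" "s \<le> t" "0 \<le> c" for c \<theta> s t
  proof -
    have "R c \<theta> s t = c * (exp (\<Gamma> t - \<Gamma> s) * exp (- \<theta> * (t - s)))"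
      by (simp add: R_def flip: exp_add)
    also have "\<dots> \<le> c * (B * exp (- \<theta> * (t - s)))"
      using N[OF that(1,2)] \<open>0 \<le> c\<close> by (intro mult_left_mono mult_right_mono) (auto simp: B_def)
    finally show ?thesis by (simp add: mult.assoc)
  qed
  have R_le_r: "R c \<theta> s t \<le> r" if "t0 \<le> s" "s \<le> t" "0 \<le> c" "c * B \<le> r" "0 \<le> \<theta>" for c \<theta> s t
  proof -
    have "R c \<theta> s t \<le> c * B * exp (- \<theta> * (t - s))" using that by (intro R_le)
    also have "\<dots> \<le> c * B * 1"
      using that \<open>B > 0\<close> by (intro mult_left_mono) auto
    finally show ?thesis using that by simp
  qed
  \<comment> \<open>With this \<open>R\<close> the margin \<open>\<gamma> - \<theta> - (p + k l)\<close> is at least \<open>v1 - \<theta>\<close>: all of \<open>v1\<close> can be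
    spent on decay (\<open>\<theta> = v1\<close>), or kept to absorb the forcing (\<open>\<theta> = 0\<close>).\<close>
  have below: "norm (x t) \<le> R c \<theta> s t"
    if sol: "ivp_solution (\<lambda>t x. A t *v x + f t x + F t) s x0 x"
      and s: "t0 \<le> s" "s \<le> t" and c: "K * norm x0 < c" "c * B \<le> r" and "0 \<le> \<theta>"
      and F: "\<And>t. t \<ge> s \<Longrightarrow> K * norm (F t) \<le> (v1 - \<theta>) * R c \<theta> s t"
    for F s x0 x t c \<theta>
  proof (rule ivp_solution_below_barrier[OF W p kc f l \<open>t0 \<le> s\<close> sol dR[OF \<open>t0 \<le> s\<close>]])
    have "0 \<le> K * norm x0" using \<open>K > 0\<close> by simp
    then have "c \<ge> 0" using c by linarith
    then have R0: "0 \<le> R c \<theta> s t" for t by (simp add: R_def)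
    show "R c \<theta> s t \<le> r" if "t \<ge> s" for t
      using R_le_r that s c \<open>c \<ge> 0\<close> \<open>0 \<le> \<theta>\<close> by blast
    have "cond_number (W s) * norm x0 \<le> K * norm x0"
      using K[OF \<open>t0 \<le> s\<close>] by (simp add: k_def mult_right_mono)
    then show "cond_number (W s) * norm x0 < R c \<theta> s s" using c by (simp add: R_def)
    fix t assume t: "t \<ge> s"
    have t0: "t \<ge> t0" using t s by simp
    have "k t * norm (F t) \<le> K * norm (F t)" using K[OF t0] by (simp add: mult_right_mono)
    then have "g t * R c \<theta> s t + k t * norm (F t) \<le> (g t + v1 - \<theta>) * R c \<theta> s t"
      using F[OF t] by (simp add: algebra_simps)
    also have "\<dots> \<le> (\<gamma> t - \<theta>) * R c \<theta> s t"
      using \<gamma>[OF t0] R0[of t] by (intro mult_right_mono) auto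
    finally show "(p t + cond_number (W t) * l t) * R c \<theta> s t + cond_number (W t) * norm (F t)
        \<le> (\<gamma> t - \<theta>) * R c \<theta> s t"
      by (simp add: g_def k_def)
  qed (use s in auto)
  have "zero_exponentially_stable (\<lambda>t x. A t *v x + f t x) t0"
    unfolding zero_exponentially_stable_def
  proof (intro exI conjI allI impI)
    show "r / (K * B) > 0" "K * B > 0" "v1 > 0"
      using \<open>r > 0\<close> \<open>K > 0\<close> \<open>B > 0\<close> \<open>v1 > 0\<close> by simp_all
    fix s x0 x t
    assume s: "t0 \<le> s" "s \<le> t"
      and *: "norm x0 < r / (K * B) \<and> ivp_solution (\<lambda>t x. A t *v x + f t x) s x0 x"
    \<comment> \<open>Barriers have to start strictly above \<open>K * norm x0\<close>, so the estimate linear in \<open>norm x0\<close>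
      is obtained as the limit \<open>c \<rightarrow> K * norm x0\<close>.\<close>
    have "norm (x t) / (B * exp (- v1 * (t - s))) \<le> K * norm x0"
    proof (rule dense_ge_bounded)
      show "K * norm x0 < r / B" using * \<open>K > 0\<close> \<open>B > 0\<close> by (simp add: field_simps)
      fix c assume c: "K * norm x0 < c" "c < r / B"
      have "0 \<le> K * norm x0" using \<open>K > 0\<close> by simp
      then have "c \<ge> 0" using c by linarith
      have "norm (x t) \<le> R c v1 s t"
        using below[of "\<lambda>_. 0" s x0 x t c v1] * s c \<open>B > 0\<close> \<open>v1 > 0\<close> by (simp add: field_simps)
      also have "\<dots> \<le> c * B * exp (- v1 * (t - s))" by (rule R_le[OF s \<open>c \<ge> 0\<close>])
      finally show "norm (x t) / (B * exp (- v1 * (t - s))) \<le> c"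
        using \<open>B > 0\<close> by (simp add: field_simps)
    qed
    then show "norm (x t) \<le> K * B * norm x0 * exp (- v1 * (t - s))"
      using \<open>B > 0\<close> by (simp add: field_simps)
  qed
  moreover have "bounded (x ` {t0..})"
    if F: "\<forall>t\<ge>t0. norm (F t) \<le> F0" "F0 \<le> v1 * r / (K * B)" and x0: "norm x0 \<le> r / (2 * K * B)"
      and sol: "ivp_solution (\<lambda>t x. A t *v x + f t x + F t) t0 x0 x" for F F0 x0 x
  proof -
    have "norm (x t) \<le> r" if t: "t \<ge> t0" for t
    proof -
      have "norm (x t) \<le> R (r / B) 0 t0 t"
      proof (rule below[OF sol order_refl t])
        have "2 * (K * norm x0) \<le> r / B" using x0 \<open>K > 0\<close> \<open>B > 0\<close> by (simp add: field_simps)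
        moreover have "0 < r / B" using \<open>r > 0\<close> \<open>B > 0\<close> by simp
        ultimately show "K * norm x0 < r / B" by linarith
        show "r / B * B \<le> r" using \<open>B > 0\<close> by simp
        fix t assume "t \<ge> t0"
        have "norm (F t) \<le> v1 * r / (K * B)" using F \<open>t \<ge> t0\<close> by force
        then have "K * norm (F t) \<le> v1 * (r / B * 1)"
          using \<open>K > 0\<close> \<open>B > 0\<close> by (simp add: field_simps)
        also have "\<dots> \<le> v1 * (r / B * exp (\<Gamma> t - \<Gamma> t0))"
          using mono[of t0 t] \<open>t \<ge> t0\<close> \<open>r > 0\<close> \<open>B > 0\<close> \<open>v1 > 0\<close>
          by (intro mult_left_mono) auto
        finally show "K * norm (F t) \<le> (v1 - 0) * R (r / B) 0 t0 t" by (simp add: R_def)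
      qed simp
      also have "\<dots> \<le> r" using R_le_r[of t0 t "r / B" 0] t \<open>r > 0\<close> \<open>B > 0\<close> by simp
      finally show ?thesis .
    qed
    then show ?thesis by (auto simp: bounded_iff)
  qed
  moreover have "v1 * r / (K * B) > 0" "r / (2 * K * B) > 0"
    using \<open>r > 0\<close> \<open>K > 0\<close> \<open>B > 0\<close> \<open>v1 > 0\<close> by simp_all
  ultimately show ?thesis by blast
qed

end
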